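(* For $i=1,2$ let $\mathcal L_i=\langle C_i,\models_{M_i}\rangle$ be a matrix logic determined by a $C_i$-matrix $M_i=(\mathbf A_i,D_i)$, where $\mathbf A_i$ has universe $A_i$. Then, for every fibring pair $(\lambda,\mu)$ (i.e. every pair of functions $\lambda:A_1\to A_2$, $\mu:A_2\to A_1$), the fibring by functions $[\mathcal L_1\circledast\mathcal L_2]_{(\lambda,\mu)}=\langle C_\circledast,\models^{\circledast}_{(\lambda,\mu)}\rangle$ (defined via simple fibred valuations) coincides with the matrix logic $\langle C_\circledast,\models_{(M_1\circledast M_2)_{(\lambda,\mu)}}\rangle$; that is, for all $\Gamma\cup\{\varphi\}\subseteq L(C_\circledast)$, $\Gamma\models^{\circledast}_{(\lambda,\mu)}\varphi$ if and only if $\Gamma\models_{(M_1\circledast M_2)_{(\lambda,\mu)}}\varphi$.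
   Context: Fix a countable set $\mathcal V=\{p_1,p_2,\dots\}$ of propositional variables. A signature $C=\{C^k\}_{k\in\mathbb N}$ is a family of pairwise disjoint sets, disjoint from $\mathcal V$ ($C^k$ is the set of $k$-ary connectives); $L(C)$ is the absolutely free algebra over $C$ generated by $\mathcal V$, and its elements are formulas. A $C$-matrix is $M=(\mathbf A,D)$ with $\mathbf A$ a $C$-algebra with universe $A$ and $D\subseteq A$. An $M$-valuation is a homomorphism $v:L(C)\to\mathbf A$ (determined by its restriction to $\mathcal V$). $\Gamma\models_M\varphi$ means: for every $M$-valuation $v$, $v(\Gamma)\subseteq D$ implies $v(\varphi)\in D$. A matrix logic here is a pair $\langle C,\models_M\rangle$. Given $C_i$-matrices $M_i=(\mathbf A_i,D_i)$ with universes $A_i$ ($i=1,2$), put $C_\circledast=C_1\uplus C_2$, $A_\circledast=A_1\uplus A_2$, $D_\circledast=D_1\uplus D_2$ (disjoint unions). A fibring pair is $(\lambda,\mu)$ with $\lambda:A_1\to A_2$, $\mu:A_2\to A_1$. Simple fibred valuations: a simple fibred valuation is a map $v:\mathcal V\to A_\circledast$, extended to $\bar v:L(C_\circledast)\to A_\circledast$ recursively by $\bar v(p)=v(p)$ for $p\in\mathcal V$, and, for $\varphi=c(\psi_1,\dots,\psi_k)$ with $c\in C_i^k$, $\bar v(\varphi)=c^{\mathbf A_i}(\tau_i(\bar v(\psi_1)),\dots,\tau_i(\bar v(\psi_k)))$, where $\tau_1(a)=a$ if $a\in A_1$ and $\tau_1(a)=\mu(a)$ if $a\in A_2$; $\tau_2(a)=a$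 if $a\in A_2$ and $\tau_2(a)=\lambda(a)$ if $a\in A_1$. It satisfies $\varphi$ if $\bar v(\varphi)\in D_\circledast$. $\Gamma\models^{\circledast}_{(\lambda,\mu)}\varphi$ iff every simple fibred valuation satisfying all formulas of $\Gamma$ satisfies $\varphi$. The fibring by functions is $[\mathcal L_1\circledast\mathcal L_2]_{(\lambda,\mu)}=\langle C_\circledast,\models^{\circledast}_{(\lambda,\mu)}\rangle$. Fibred matrix: define $\ast_\lambda:A_\circledast\to A_2$ by $\ast_\lambda(x)=\lambda(x)$ if $x\in A_1$, $\ast_\lambda(x)=x$ if $x\in A_2$; and $\ast_\mu:A_\circledast\to A_1$ by $\ast_\mu(x)=x$ if $x\in A_1$, $\ast_\mu(x)=\mu(x)$ if $x\in A_2$. The $C_\circledast$-matrix $(M_1\circledast M_2)_{(\lambda,\mu)}$ has universe $A_\circledast$, designated set $D_\circledast$, and operations $c(x_1,\dots,x_k)=c^{\mathbf A_1}(\ast_\mu(x_1),\dots,\ast_\mu(x_k))$ for $c\in C_1^k$ and $c(x_1,\dots,x_k)=c^{\mathbf A_2}(\ast_\lambda(x_1),\dots,\ast_\lambda(x_k))$ for $c\in C_2^k$. *)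

theory Defs
  imports Main "HOL-Library.FuncSet" "HOL-Library.Disjoint_Sets"
begin

text \<open>
  A signature is a family \<open>C\<close> of sets, \<open>C k\<close> being the set of \<open>k\<close>-ary connectives. Since the
  \<open>C k\<close> are pairwise disjoint, the arity of a connective is determined by the connective itself.
\<close>

type_synonym 'c sig = "nat \<Rightarrow> 'c set"

definition signature :: "'c sig \<Rightarrow> bool" where
  "signature C \<longleftrightarrow> disjoint_family C"

text \<open>
  The propositional variables are \<open>Var 0, Var 1, \<dots>\<close>. The datatype contains all trees over the
  symbols in \<open>'c\<close>, regardless of arities; \<open>L(C)\<close> is carved out of it by \<open>formulas C\<close>. Variables
  and connectives are distinct by construction.
\<close>

datatype 'c fm = Var nat | App 'c "'c fm list"

inductive_set formulas :: "'c sig \<Rightarrow> 'c fm set" for C :: "'c sig" where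
  Var: "Var n \<in> formulas C"
| App: "\<lbrakk>c \<in> C k; length ts = k; \<And>t. t \<in> set ts \<Longrightarrow> t \<in> formulas C\<rbrakk>
        \<Longrightarrow> App c ts \<in> formulas C"

text \<open>
  The values of \<open>intp\<close> outside the signature, on lists of the wrong length, or outside the
  universe are irrelevant.
\<close>

record ('c, 'a) alg =
  universe :: "'a set"
  intp :: "'c \<Rightarrow> 'a list \<Rightarrow> 'a"

record ('c, 'a) matrix = "('c, 'a) alg" +
  desig :: "'a set"

definition is_algebra :: "'c sig \<Rightarrow> ('c, 'a, 'm) alg_scheme \<Rightarrow> bool" where
  "is_algebra C A \<longleftrightarrow>
     (\<forall>k. \<forall>c\<in>C k. \<forall>xs. length xs = k \<and> set xs \<subseteq> universe A \<longrightarrow> intp A c xs \<in> universe A)"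

definition is_matrix :: "'c sig \<Rightarrow> ('c, 'a) matrix \<Rightarrow> bool" where
  "is_matrix C M \<longleftrightarrow> is_algebra C M \<and> desig M \<subseteq> universe M"

text \<open>Valuations are homomorphisms on \<open>L(C)\<close>; their values on other trees are irrelevant.\<close>

definition valuation :: "'c sig \<Rightarrow> ('c, 'a) matrix \<Rightarrow> ('c fm \<Rightarrow> 'a) \<Rightarrow> bool" where
  "valuation C M v \<longleftrightarrow>
     v \<in> formulas C \<rightarrow> universe M \<and>
     (\<forall>k. \<forall>c\<in>C k. \<forall>ts. length ts = k \<and> set ts \<subseteq> formulas C
        \<longrightarrow> v (App c ts) = intp M c (map v ts))"

definition matrix_entails ::
  "'c sig \<Rightarrow> ('c, 'a) matrix \<Rightarrow> 'c fm set \<Rightarrow> 'c fm \<Rightarrow> bool" where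
  "matrix_entails C M \<Gamma> \<phi> \<longleftrightarrow>
     (\<forall>v. valuation C M v \<longrightarrow> v ` \<Gamma> \<subseteq> desig M \<longrightarrow> v \<phi> \<in> desig M)"

type_synonym 'c logic = "'c sig \<times> ('c fm set \<times> 'c fm) set"

text \<open>A logic over \<open>C\<close> with its consequence relation confined to formulas of \<open>L(C)\<close>.\<close>

definition logic_of :: "'c sig \<Rightarrow> ('c fm set \<Rightarrow> 'c fm \<Rightarrow> bool) \<Rightarrow> 'c logic" where
  "logic_of C E = (C, {(\<Gamma>, \<phi>). \<Gamma> \<union> {\<phi>} \<subseteq> formulas C \<and> E \<Gamma> \<phi>})"

definition matrix_logic :: "'c sig \<Rightarrow> ('c, 'a) matrix \<Rightarrow> 'c logic" where
  "matrix_logic C M = logic_of C (matrix_entails C M)"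

definition sum_sig :: "'c sig \<Rightarrow> 'd sig \<Rightarrow> ('c + 'd) sig" where
  "sum_sig C1 C2 = (\<lambda>k. C1 k <+> C2 k)"

definition sum_univ :: "('c, 'a) matrix \<Rightarrow> ('d, 'b) matrix \<Rightarrow> ('a + 'b) set" where
  "sum_univ M1 M2 = universe M1 <+> universe M2"

definition sum_desig :: "('c, 'a) matrix \<Rightarrow> ('d, 'b) matrix \<Rightarrow> ('a + 'b) set" where
  "sum_desig M1 M2 = desig M1 <+> desig M2"

definition fibring_pair ::
  "('c, 'a) matrix \<Rightarrow> ('d, 'b) matrix \<Rightarrow> ('a \<Rightarrow> 'b) \<Rightarrow> ('b \<Rightarrow> 'a) \<Rightarrow> bool" where
  "fibring_pair M1 M2 lam mu \<longleftrightarrow> lam \<in> universe M1 \<rightarrow> universe M2 \<and> mu \<in> universe M2 \<rightarrow> universe M1"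

fun tau1 :: "('b \<Rightarrow> 'a) \<Rightarrow> 'a + 'b \<Rightarrow> 'a" where
  "tau1 mu (Inl a) = a"
| "tau1 mu (Inr b) = mu b"

fun tau2 :: "('a \<Rightarrow> 'b) \<Rightarrow> 'a + 'b \<Rightarrow> 'b" where
  "tau2 lam (Inl a) = lam a"
| "tau2 lam (Inr b) = b"

definition simple_fibred_valuation ::
  "('c, 'a) matrix \<Rightarrow> ('d, 'b) matrix \<Rightarrow> (nat \<Rightarrow> 'a + 'b) \<Rightarrow> bool" where
  "simple_fibred_valuation M1 M2 v \<longleftrightarrow> (\<forall>n. v n \<in> sum_univ M1 M2)"

fun sfv_ext ::
  "('c, 'a) matrix \<Rightarrow> ('d, 'b) matrix \<Rightarrow> ('a \<Rightarrow> 'b) \<Rightarrow> ('b \<Rightarrow> 'a) \<Rightarrow>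
     (nat \<Rightarrow> 'a + 'b) \<Rightarrow> ('c + 'd) fm \<Rightarrow> 'a + 'b" where
  "sfv_ext M1 M2 lam mu v (Var n) = v n"
| "sfv_ext M1 M2 lam mu v (App (Inl c) ts) =
     Inl (intp M1 c (map (\<lambda>t. tau1 mu (sfv_ext M1 M2 lam mu v t)) ts))"
| "sfv_ext M1 M2 lam mu v (App (Inr c) ts) =
     Inr (intp M2 c (map (\<lambda>t. tau2 lam (sfv_ext M1 M2 lam mu v t)) ts))"

definition sfv_satisfies ::
  "('c, 'a) matrix \<Rightarrow> ('d, 'b) matrix \<Rightarrow> ('a \<Rightarrow> 'b) \<Rightarrow> ('b \<Rightarrow> 'a) \<Rightarrow>
     (nat \<Rightarrow> 'a + 'b) \<Rightarrow> ('c + 'd) fm \<Rightarrow> bool" where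
  "sfv_satisfies M1 M2 lam mu v \<phi> \<longleftrightarrow> sfv_ext M1 M2 lam mu v \<phi> \<in> sum_desig M1 M2"

definition fibring_entails ::
  "('c, 'a) matrix \<Rightarrow> ('d, 'b) matrix \<Rightarrow> ('a \<Rightarrow> 'b) \<Rightarrow> ('b \<Rightarrow> 'a) \<Rightarrow>
     ('c + 'd) fm set \<Rightarrow> ('c + 'd) fm \<Rightarrow> bool" where
  "fibring_entails M1 M2 lam mu \<Gamma> \<phi> \<longleftrightarrow>
     (\<forall>v. simple_fibred_valuation M1 M2 v \<longrightarrow>
        (\<forall>\<gamma>\<in>\<Gamma>. sfv_satisfies M1 M2 lam mu v \<gamma>) \<longrightarrow> sfv_satisfies M1 M2 lam mu v \<phi>)"

text \<open>
  The fibring depends on the matrices presenting the two matrix logics, not only on their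
  consequence relations, so it takes the matrices as arguments.
\<close>

definition fibring_by_functions ::
  "'c sig \<Rightarrow> ('c, 'a) matrix \<Rightarrow> 'd sig \<Rightarrow> ('d, 'b) matrix \<Rightarrow> ('a \<Rightarrow> 'b) \<Rightarrow> ('b \<Rightarrow> 'a) \<Rightarrow>
     ('c + 'd) logic" where
  "fibring_by_functions C1 M1 C2 M2 lam mu =
     logic_of (sum_sig C1 C2) (fibring_entails M1 M2 lam mu)"

fun star_lam :: "('a \<Rightarrow> 'b) \<Rightarrow> 'a + 'b \<Rightarrow> 'b" where
  "star_lam lam (Inl x) = lam x"
| "star_lam lam (Inr x) = x"

fun star_mu :: "('b \<Rightarrow> 'a) \<Rightarrow> 'a + 'b \<Rightarrow> 'a" where
  "star_mu mu (Inl x) = x"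
| "star_mu mu (Inr x) = mu x"

fun fibred_op ::
  "('c, 'a) matrix \<Rightarrow> ('d, 'b) matrix \<Rightarrow> ('a \<Rightarrow> 'b) \<Rightarrow> ('b \<Rightarrow> 'a) \<Rightarrow>
     'c + 'd \<Rightarrow> ('a + 'b) list \<Rightarrow> 'a + 'b" where
  "fibred_op M1 M2 lam mu (Inl c) xs = Inl (intp M1 c (map (star_mu mu) xs))"
| "fibred_op M1 M2 lam mu (Inr c) xs = Inr (intp M2 c (map (star_lam lam) xs))"

definition fibred_matrix ::
  "('c, 'a) matrix \<Rightarrow> ('d, 'b) matrix \<Rightarrow> ('a \<Rightarrow> 'b) \<Rightarrow> ('b \<Rightarrow> 'a) \<Rightarrow> ('c + 'd, 'a + 'b) matrix"
  where
  "fibred_matrix M1 M2 lam mu =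
     \<lparr> universe = sum_univ M1 M2, intp = fibred_op M1 M2 lam mu, desig = sum_desig M1 M2 \<rparr>"

lemma signature_sum_sig:
  assumes "signature C1" "signature C2"
  shows "signature (sum_sig C1 C2)"
  using assms by (fastforce simp: signature_def sum_sig_def disjoint_family_on_def)

lemma is_matrix_fibred_matrix:
  assumes "is_matrix C1 M1" "is_matrix C2 M2" "fibring_pair M1 M2 lam mu"
  shows "is_matrix (sum_sig C1 C2) (fibred_matrix M1 M2 lam mu)"
proof -
  have mu: "star_mu mu x \<in> universe M1" and lam: "star_lam lam x \<in> universe M2"
    if "x \<in> sum_univ M1 M2" for x
    using that assms(3) by (auto simp: sum_univ_def fibring_pair_def)
  have m: "set (map (star_mu mu) xs) \<subseteq> universe M1" and l: "set (map (star_lam lam) xs) \<subseteq> universe M2"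
    if "set xs \<subseteq> sum_univ M1 M2" for xs
    using that mu lam by auto
  have "fibred_op M1 M2 lam mu c xs \<in> sum_univ M1 M2"
    if c: "c \<in> sum_sig C1 C2 (length xs)" and xs: "set xs \<subseteq> sum_univ M1 M2" for c xs
  proof (cases c)
    case (Inl d)
    then have "d \<in> C1 (length (map (star_mu mu) xs))"
      using c by (auto simp: sum_sig_def)
    then have "intp M1 d (map (star_mu mu) xs) \<in> universe M1"
      using assms(1) m[OF xs] unfolding is_matrix_def is_algebra_def by blast
    then show ?thesis by (auto simp: Inl sum_univ_def)
  next
    case (Inr d)
    then have "d \<in> C2 (length (map (star_lam lam) xs))"
      using c by (auto simp: sum_sig_def)
    then have "intp M2 d (map (star_lam lam) xs) \<in> universe M2"
      using assms(2) l[OF xs] unfolding is_matrix_def is_algebra_def by blast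
    then show ?thesis by (auto simp: Inr sum_univ_def)
  qed
  moreover have "sum_desig M1 M2 \<subseteq> sum_univ M1 M2"
    using assms(1,2) by (auto simp: is_matrix_def sum_desig_def sum_univ_def)
  ultimately show ?thesis
    by (auto simp: is_matrix_def is_algebra_def fibred_matrix_def)
qed

end

theory Submission imports Defs begin

text \<open>
  Simple fibred valuations, extended to formulas, are exactly the homomorphisms into the fibred
  matrix: the operations of that matrix apply the same coercions as the recursive clauses, so
  restriction to the variables is a bijection.
\<close>

lemma tau1_eq_star_mu: "tau1 mu x = star_mu mu x"
  by (cases x) simp_all

lemma tau2_eq_star_lam: "tau2 lam x = star_lam lam x"
  by (cases x) simp_all

text \<open>Merges the two recursive clauses into one homomorphism equation, possible because
  \<open>tau1\<close>, \<open>tau2\<close> are the same coercions as \<open>star_mu\<close>,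
  \<open>star_lam\<close>. The lemmas on valuations below treat compound formulas only through
  it.\<close>

lemma sfv_ext_App:
  "sfv_ext M1 M2 lam mu v (App c ts) = fibred_op M1 M2 lam mu c (map (sfv_ext M1 M2 lam mu v) ts)"
  by (cases c) (simp_all add: tau1_eq_star_mu tau2_eq_star_lam comp_def)

text \<open>The homomorphism equation is \<open>sfv_ext_App\<close>; the content is that values on
  formulas stay in the universe, by induction using closure of the fibred operations.\<close>

lemma valuation_sfv_ext:
  assumes "is_matrix C (fibred_matrix M1 M2 lam mu)"
    and "simple_fibred_valuation M1 M2 v"
  shows "valuation C (fibred_matrix M1 M2 lam mu) (sfv_ext M1 M2 lam mu v)"
proof -
  have "sfv_ext M1 M2 lam mu v \<phi> \<in> sum_univ M1 M2" if "\<phi> \<in> formulas C" for \<phi>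
    using that
  proof induction
    case (Var n)
    then show ?case
      using assms(2) by (simp add: simple_fibred_valuation_def)
  next
    case (App c k ts)
    then have "set (map (sfv_ext M1 M2 lam mu v) ts) \<subseteq> sum_univ M1 M2"
      by auto
    then show ?case
      using assms(1) App.hyps(1,2)
      by (auto simp: sfv_ext_App is_matrix_def is_algebra_def fibred_matrix_def)
  qed
  then show ?thesis
    by (simp add: valuation_def fibred_matrix_def sfv_ext_App)
qed

text \<open>A homomorphism is determined by its values on the variables. The claim stops at formulas
  because a valuation is arbitrary on ill-formed trees.\<close>

lemma valuation_eq_sfv_ext:
  assumes "valuation C (fibred_matrix M1 M2 lam mu) w" and "\<phi> \<in> formulas C"
  shows "w \<phi> = sfv_ext M1 M2 lam mu (\<lambda>n. w (Var n)) \<phi>"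
  using assms(2)
proof induction
  case (Var n)
  then show ?case by simp
next
  case (App c k ts)
  then have "w (App c ts) = fibred_op M1 M2 lam mu c (map w ts)"
    using assms(1) by (auto simp: valuation_def fibred_matrix_def subset_iff)
  also have "map w ts = map (sfv_ext M1 M2 lam mu (\<lambda>n. w (Var n))) ts"
    using App.IH by simp
  finally show ?case
    by (simp only: sfv_ext_App)
qed

lemma simple_fibred_valuation_restrict:
  assumes "valuation C (fibred_matrix M1 M2 lam mu) w"
  shows "simple_fibred_valuation M1 M2 (\<lambda>n. w (Var n))"
  using assms formulas.Var[of _ C]
  by (auto simp: valuation_def simple_fibred_valuation_def fibred_matrix_def)

lemma fibring_entails_iff_matrix_entails:
  assumes M: "is_matrix C (fibred_matrix M1 M2 lam mu)"
    and formulas: "\<Gamma> \<union> {\<phi>} \<subseteq> formulas C"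
  shows "fibring_entails M1 M2 lam mu \<Gamma> \<phi> \<longleftrightarrow> matrix_entails C (fibred_matrix M1 M2 lam mu) \<Gamma> \<phi>"
proof
  assume fib: "fibring_entails M1 M2 lam mu \<Gamma> \<phi>"
  show "matrix_entails C (fibred_matrix M1 M2 lam mu) \<Gamma> \<phi>"
    unfolding matrix_entails_def
  proof (intro allI impI)
    fix w
    assume w: "valuation C (fibred_matrix M1 M2 lam mu) w"
      and \<Gamma>: "w ` \<Gamma> \<subseteq> desig (fibred_matrix M1 M2 lam mu)"
    \<comment> \<open>Since \<open>\<Gamma>\<close> and \<open>\<phi>\<close> consist of formulas,
      \<open>w\<close> agrees on them with the extension of its restriction to the
      variables.\<close>
    have sat: "sfv_satisfies M1 M2 lam mu (\<lambda>n. w (Var n)) \<psi>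
        \<longleftrightarrow> w \<psi> \<in> desig (fibred_matrix M1 M2 lam mu)" if "\<psi> \<in> \<Gamma> \<union> {\<phi>}" for \<psi>
      using valuation_eq_sfv_ext[OF w, of \<psi>] that formulas
      by (auto simp: sfv_satisfies_def fibred_matrix_def)
    have "sfv_satisfies M1 M2 lam mu (\<lambda>n. w (Var n)) \<phi>"
      using fib simple_fibred_valuation_restrict[OF w] \<Gamma> sat
      by (auto simp: fibring_entails_def)
    then show "w \<phi> \<in> desig (fibred_matrix M1 M2 lam mu)"
      using sat by simp
  qed
next
  assume "matrix_entails C (fibred_matrix M1 M2 lam mu) \<Gamma> \<phi>"
  \<comment> \<open>The extension of a simple fibred valuation is itself a valuation, so matrix
    entailment applies to it directly.\<close>
  then show "fibring_entails M1 M2 lam mu \<Gamma> \<phi>"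
    using valuation_sfv_ext[OF M]
    by (auto simp: matrix_entails_def fibring_entails_def sfv_satisfies_def fibred_matrix_def
        image_subset_iff)
qed

theorem theorem2p10:
  fixes C1 :: "'c sig" and C2 :: "'d sig"
    and M1 :: "('c, 'a) matrix" and M2 :: "('d, 'b) matrix"
    and lam :: "'a \<Rightarrow> 'b" and mu :: "'b \<Rightarrow> 'a"
  assumes "signature C1" and "signature C2"
    and "is_matrix C1 M1" and "is_matrix C2 M2"
    and "fibring_pair M1 M2 lam mu"
  shows "fibring_by_functions C1 M1 C2 M2 lam mu
           = matrix_logic (sum_sig C1 C2) (fibred_matrix M1 M2 lam mu)
         \<and> (\<forall>\<Gamma> \<phi>. \<Gamma> \<union> {\<phi>} \<subseteq> formulas (sum_sig C1 C2) \<longrightarrow>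
              (fibring_entails M1 M2 lam mu \<Gamma> \<phi>
                 \<longleftrightarrow> matrix_entails (sum_sig C1 C2) (fibred_matrix M1 M2 lam mu) \<Gamma> \<phi>))"
proof -
  have "is_matrix (sum_sig C1 C2) (fibred_matrix M1 M2 lam mu)"
    using assms(3-5) by (rule is_matrix_fibred_matrix)
  note eq = fibring_entails_iff_matrix_entails[OF this]
  \<comment> \<open>\<open>logic_of\<close> keeps only pairs of formulas, so the equivalence on
    formulas gives equality of the logics.\<close>
  then have "fibring_by_functions C1 M1 C2 M2 lam mu
      = matrix_logic (sum_sig C1 C2) (fibred_matrix M1 M2 lam mu)"
    unfolding fibring_by_functions_def matrix_logic_def logic_of_def by blast
  with eq show ?thesis by blast
qed

end
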